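(* Let $\alpha\ge 3$ and $\beta>\frac12$. There exist constants $c_{\alpha,\beta}>0$ and $C_{\alpha,\beta}>0$, depending only on $\alpha$ and $\beta$, such that the following holds for every $n$, every $L>0$, every $f\in\mathcal{F}^1_L(\mathbb{R}^n)$ with a minimizer $x^\star$, every $x_0\in\mathbb{R}^n$ and every step size $0<s\le c_{\alpha,\beta}/L$: the iterates $\{x_k\}_{k=0}^\infty$ generated by the generalized NAG-C $$y_{k+1}=x_k-\beta s\nabla f(x_k),\qquad x_{k+1}=x_k-s\nabla f(x_k)+\frac{k}{k+\alpha}(y_{k+1}-y_k)\qquad(k\ge 0),$$ started with $y_0=x_0$, obey $$\min_{0\le i\le k}\|\nabla f(x_i)\|^2\le \frac{C_{\alpha,\beta}\|x_0-x^\star\|^2}{s^2(k+1)^3}$$ for all $k\ge 0$, and in addition $$f(x_k)-f(x^\star)\le \frac{C_{\alpha,\beta}\|x_0-x^\star\|^2}{s(k+1)^2}$$ for all $k\ge 0$.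
   Context: $\|\cdot\|$ is the Euclidean norm. $\mathcal{F}^1_L(\mathbb{R}^n)$ is the class of differentiable convex functions $f:\mathbb{R}^n\to\mathbb{R}$ whose gradient is $L$-Lipschitz: $\|\nabla f(x)-\nabla f(y)\|\le L\|x-y\|$ for all $x,y\in\mathbb{R}^n$. *)

theory Defs
  imports "HOL-Analysis.Analysis"
begin

text \<open>
  The constants of the theorem have to be chosen before the dimension \<open>n\<close>, so \<open>n\<close> cannot be the
  index type of \<open>real ^ 'n\<close>. All the Euclidean spaces are therefore placed in one inner product
  space, the finitely supported real sequences with the dot product; \<open>Rn n\<close> consists of
  the sequences supported on the first \<open>n\<close> coordinates.
\<close>

typedef fin_seq = "{x :: nat \<Rightarrow> real. finite {i. x i \<noteq> 0}}"
  morphisms coord Abs_fin_seq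
  by (rule exI[of _ "\<lambda>_. 0"]) simp

setup_lifting type_definition_fin_seq

lemma finite_support [simp]: "finite {i. coord x i \<noteq> 0}"
  using coord[of x] by simp

lemma fin_seq_eqI: "(\<And>i. coord x i = coord y i) \<Longrightarrow> x = y"
  by (simp add: coord_inject[symmetric] fun_eq_iff)

instantiation fin_seq :: real_vector
begin

lift_definition zero_fin_seq :: fin_seq is "\<lambda>_. 0"
  by simp

lift_definition plus_fin_seq :: "fin_seq \<Rightarrow> fin_seq \<Rightarrow> fin_seq" is "\<lambda>x y i. x i + y i"
  by (erule (1) finite_subset[OF _ finite_UnI, rotated]) auto

lift_definition minus_fin_seq :: "fin_seq \<Rightarrow> fin_seq \<Rightarrow> fin_seq" is "\<lambda>x y i. x i - y i"
  by (erule (1) finite_subset[OF _ finite_UnI, rotated]) auto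

lift_definition uminus_fin_seq :: "fin_seq \<Rightarrow> fin_seq" is "\<lambda>x i. - x i"
  by simp

lift_definition scaleR_fin_seq :: "real \<Rightarrow> fin_seq \<Rightarrow> fin_seq" is "\<lambda>r x i. r * x i"
  by (erule finite_subset[rotated]) auto

instance
  by standard (transfer; simp add: fun_eq_iff algebra_simps)+

end

lemma coord_simps [simp]:
  "coord 0 i = 0"
  "coord (x + y) i = coord x i + coord y i"
  "coord (x - y) i = coord x i - coord y i"
  "coord (- x) i = - coord x i"
  "coord (r *\<^sub>R x) i = r * coord x i"
  by (transfer; simp)+

instantiation fin_seq :: real_inner
begin

definition inner_fin_seq :: "fin_seq \<Rightarrow> fin_seq \<Rightarrow> real" where
  "inner_fin_seq x y = (\<Sum>i | coord x i \<noteq> 0. coord x i * coord y i)"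

definition norm_fin_seq :: "fin_seq \<Rightarrow> real" where
  "norm_fin_seq x = sqrt (inner x x)"

definition sgn_fin_seq :: "fin_seq \<Rightarrow> fin_seq" where
  "sgn_fin_seq x = x /\<^sub>R norm x"

definition dist_fin_seq :: "fin_seq \<Rightarrow> fin_seq \<Rightarrow> real" where
  "dist_fin_seq x y = norm (x - y)"

definition uniformity_fin_seq :: "(fin_seq \<times> fin_seq) filter" where
  "uniformity_fin_seq = (INF e\<in>{0<..}. principal {(x, y). dist x y < e})"

definition open_fin_seq :: "fin_seq set \<Rightarrow> bool" where
  "open_fin_seq U \<longleftrightarrow> (\<forall>x\<in>U. eventually (\<lambda>(x', y). x' = x \<longrightarrow> y \<in> U) uniformity)"

lemma inner_fin_seq_superset:
  assumes "finite A" "{i. coord x i \<noteq> 0} \<subseteq> A"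
  shows "inner x y = (\<Sum>i\<in>A. coord x i * coord y i)"
  unfolding inner_fin_seq_def by (rule sum.mono_neutral_left) (use assms in auto)

instance
proof
  fix x y z :: fin_seq and r :: real
  let ?A = "{i. coord x i \<noteq> 0} \<union> {i. coord y i \<noteq> 0}"
  have fin: "finite ?A" by simp
  show "inner x y = inner y x"
    by (subst (1 2) inner_fin_seq_superset[OF fin]) (auto simp: mult.commute)
  show "inner (x + y) z = inner x z + inner y z"
    by (subst (1 2 3) inner_fin_seq_superset[OF fin])
       (auto simp: algebra_simps sum.distrib)
  show "inner (r *\<^sub>R x) y = r * inner x y"
    by (subst (1 2) inner_fin_seq_superset[OF fin])
       (auto simp: algebra_simps sum_distrib_left)
  show "0 \<le> inner x x"
    by (auto simp: inner_fin_seq_def intro!: sum_nonneg)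
  show "(inner x x = 0) = (x = 0)"
    by (auto simp: inner_fin_seq_def sum_nonneg_eq_0_iff intro!: fin_seq_eqI)
qed (simp_all add: norm_fin_seq_def sgn_fin_seq_def dist_fin_seq_def
       uniformity_fin_seq_def open_fin_seq_def)

end

definition Rn :: "nat \<Rightarrow> fin_seq set" where
  "Rn n = {x. \<forall>i\<ge>n. coord x i = 0}"

lemma inner_Rn: "x \<in> Rn n \<Longrightarrow> inner x y = (\<Sum>i<n. coord x i * coord y i)"
  by (rule inner_fin_seq_superset) (auto simp: Rn_def intro: leI)

lemma norm_Rn: "x \<in> Rn n \<Longrightarrow> norm x = sqrt (\<Sum>i<n. (coord x i)\<^sup>2)"
  by (simp add: norm_eq_sqrt_inner inner_Rn power2_eq_square)

lemma subspace_Rn: "subspace (Rn n)"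
  by (auto simp: subspace_def Rn_def)

lemma Rn_coords: "\<exists>!x. x \<in> Rn n \<and> (\<forall>i<n. coord x i = v i)"
proof
  have "finite {i. (if i < n then v i else 0) \<noteq> (0::real)}"
    by (rule finite_subset[of _ "{..<n}"]) (auto split: if_splits)
  then show "Abs_fin_seq (\<lambda>i. if i < n then v i else 0) \<in> Rn n \<and>
      (\<forall>i<n. coord (Abs_fin_seq (\<lambda>i. if i < n then v i else 0)) i = v i)"
    by (auto simp: Rn_def Abs_fin_seq_inverse)
next
  fix x assume x: "x \<in> Rn n \<and> (\<forall>i<n. coord x i = v i)"
  have "coord x = (\<lambda>i. if i < n then v i else 0)"
    using x by (simp add: Rn_def fun_eq_iff)
  then show "x = Abs_fin_seq (\<lambda>i. if i < n then v i else 0)"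
    by (metis coord_inverse)
qed

text \<open>
  Derivatives are taken within \<open>Rn n\<close>, so functions on \<open>\<real>\<^sup>n\<close> are functions on \<open>fin_seq\<close> whose values
  outside \<open>Rn n\<close> are irrelevant.
\<close>

definition grad :: "nat \<Rightarrow> (fin_seq \<Rightarrow> real) \<Rightarrow> fin_seq \<Rightarrow> fin_seq" where
  "grad n f x = (THE g. g \<in> Rn n \<and> (f has_derivative (\<lambda>h. inner g h)) (at x within Rn n))"

lemma gradient_unique:
  assumes x: "x \<in> Rn n" and g: "g \<in> Rn n" "g' \<in> Rn n"
    and d: "(f has_derivative (\<lambda>h. inner g h)) (at x within Rn n)"
      "(f has_derivative (\<lambda>h. inner g' h)) (at x within Rn n)"
  shows "g = g'"
proof -
  let ?u = "g - g'"
  have u: "x + t *\<^sub>R ?u \<in> Rn n" for t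
    using x g by (auto simp: Rn_def)
  have line: "((\<lambda>t::real. x + t *\<^sub>R ?u) has_derivative (\<lambda>t. t *\<^sub>R ?u)) (at 0)"
    by (auto intro!: derivative_eq_intros)
  have sub: "range (\<lambda>t::real. x + t *\<^sub>R ?u) \<subseteq> Rn n"
    using u by auto
  have "((\<lambda>t. f (x + t *\<^sub>R ?u)) has_derivative (\<lambda>t. inner a (t *\<^sub>R ?u))) (at 0)"
    if "(f has_derivative (\<lambda>h. inner a h)) (at x within Rn n)" for a
    using has_derivative_in_compose[OF line, of f "\<lambda>h. inner a h"] that
      has_derivative_subset[OF _ sub, of f "\<lambda>h. inner a h" x] by simp
  from has_derivative_unique[OF this[OF d(1)] this[OF d(2)]]
  have "inner g ?u = inner g' ?u"
    by (metis scaleR_one)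
  then have "inner ?u ?u = 0"
    by (simp add: inner_diff_left)
  then show ?thesis by simp
qed

lemma grad_eqI:
  assumes "x \<in> Rn n" "g \<in> Rn n" "(f has_derivative (\<lambda>h. inner g h)) (at x within Rn n)"
  shows "grad n f x = g"
  unfolding grad_def by (rule the_equality) (use assms gradient_unique in blast)+

lemma grad_works:
  assumes x: "x \<in> Rn n" and "f differentiable (at x within Rn n)"
  shows "grad n f x \<in> Rn n"
    and "(f has_derivative (\<lambda>h. inner (grad n f x) h)) (at x within Rn n)"
proof -
  from assms obtain D where D: "(f has_derivative D) (at x within Rn n)"
    unfolding differentiable_def by blast
  then interpret D: bounded_linear D
    by (rule has_derivative_bounded_linear)
  define e where "e i = Abs_fin_seq (\<lambda>j. if j = i then 1 else 0)" for i
  have e: "coord (e i) j = (if j = i then 1 else 0)" for i j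
    unfolding e_def by (subst Abs_fin_seq_inverse) auto
  have coord_sum: "coord (\<Sum>i\<in>A. F i) j = (\<Sum>i\<in>A. coord (F i) j)" for A F j
    by (induction A rule: infinite_finite_induct) auto
  define g where "g = (\<Sum>i<n. D (e i) *\<^sub>R e i)"
  have gc: "coord g j = (if j < n then D (e j) else 0)" for j
    by (auto simp: g_def coord_sum e if_distrib cong: if_cong)
  have g: "g \<in> Rn n"
    by (simp add: Rn_def gc)
  have Dg: "D h = inner g h" if "h \<in> Rn n" for h
  proof -
    have "h = (\<Sum>i<n. coord h i *\<^sub>R e i)"
      using that by (intro fin_seq_eqI) (auto simp: coord_sum e if_distrib Rn_def cong: if_cong)
    then have "D h = D (\<Sum>i<n. coord h i *\<^sub>R e i)"
      by (rule arg_cong)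
    also have "\<dots> = (\<Sum>i<n. coord h i * D (e i))"
      by (simp add: D.sum D.scaleR)
    also have "\<dots> = inner g h"
      by (simp add: inner_Rn[OF g] gc mult.commute)
    finally show ?thesis .
  qed
  have fg: "(f has_derivative (\<lambda>h. inner g h)) (at x within Rn n)"
    using D unfolding has_derivative_within'
    by (auto simp: bounded_linear_inner_right Dg subspace_diff[OF subspace_Rn] x)
  have eq: "grad n f x = g"
    by (rule grad_eqI[OF x g fg])
  show "grad n f x \<in> Rn n"
    unfolding eq by (rule g)
  show "(f has_derivative (\<lambda>h. inner (grad n f x) h)) (at x within Rn n)"
    unfolding eq by (rule fg)
qed

definition F1 :: "nat \<Rightarrow> real \<Rightarrow> (fin_seq \<Rightarrow> real) set" where
  "F1 n L = {f. f differentiable_on Rn n \<and> convex_on (Rn n) f \<and>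
    (\<forall>x\<in>Rn n. \<forall>y\<in>Rn n. norm (grad n f x - grad n f y) \<le> L * norm (x - y))}"

definition minimizer :: "nat \<Rightarrow> (fin_seq \<Rightarrow> real) \<Rightarrow> fin_seq \<Rightarrow> bool" where
  "minimizer n f z \<longleftrightarrow> z \<in> Rn n \<and> (\<forall>x\<in>Rn n. f z \<le> f x)"

definition NAG_C ::
  "nat \<Rightarrow> (fin_seq \<Rightarrow> real) \<Rightarrow> real \<Rightarrow> real \<Rightarrow> real \<Rightarrow> fin_seq \<Rightarrow> (nat \<Rightarrow> fin_seq) \<Rightarrow> (nat \<Rightarrow> fin_seq) \<Rightarrow> bool"
where
  "NAG_C n f \<alpha> \<beta> s x0 x y \<longleftrightarrow> x 0 = x0 \<and> y 0 = x0 \<and>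
    (\<forall>k. y (Suc k) = x k - (\<beta> * s) *\<^sub>R grad n f (x k)) \<and>
    (\<forall>k. x (Suc k) = x k - s *\<^sub>R grad n f (x k) +
           (real k / (real k + \<alpha>)) *\<^sub>R (y (Suc k) - y k))"

end

theory Submission
  imports Defs
begin

text \<open>
  Put \<open>V\<^sub>k = k (x\<^sub>k - y\<^sub>k) + (\<alpha> - 1) (x\<^sub>k - x\<^sup>\<star>)\<close>. The recursion gives the exact identity
  \<open>V\<^sub>k\<^sub>+\<^sub>1 = V\<^sub>k - (k + \<alpha> - \<beta>) s \<nabla>f(x\<^sub>k)\<close>, so in the energy
  \<open>E\<^sub>k = (k + \<alpha> - \<beta>) (k + \<alpha> - 1) s (f(x\<^sub>k) - f(x\<^sup>\<star>)) + \<bar>V\<^sub>k\<^sub>+\<^sub>1\<bar>\<^sup>2 / 2\<close> the square grows by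
  \<open>k\<^sup>2 s\<^sup>2 \<bar>\<nabla>f(x\<^sub>k)\<bar>\<^sup>2 / 2\<close> to leading order, while the term \<open>\<beta> s \<nabla>f(x\<^sub>k\<^sub>-\<^sub>1)\<close> of \<open>x\<^sub>k - y\<^sub>k\<close> contributes
  about \<open>- \<beta> k\<^sup>2 s\<^sup>2 \<bar>\<nabla>f(x\<^sub>k)\<bar>\<^sup>2\<close>; this is where \<open>\<beta> > 1/2\<close> enters. The function values cancel up to a
  multiple of \<open>f(x\<^sub>k) - f(x\<^sup>\<star>)\<close> bounded above in \<open>k\<close> because \<open>\<alpha> \<ge> 3\<close>, which is \<open>O(E\<^sub>k / k\<^sup>2)\<close> and is absorbed by a Gronwall
  argument. Hence \<open>E\<^sub>k\<close> and \<open>\<Sum> k\<^sup>2 s\<^sup>2 \<bar>\<nabla>f(x\<^sub>k)\<bar>\<^sup>2\<close> stay bounded by a multiple of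
  \<open>\<bar>x\<^sub>0 - x\<^sup>\<star>\<bar>\<^sup>2\<close>. The finitely many initial steps, where the coefficients may have the wrong sign,
  are covered by the exponential bound \<open>\<bar>x\<^sub>k - x\<^sup>\<star>\<bar> \<le> (4 + \<beta>)\<^sup>k \<bar>x\<^sub>0 - x\<^sup>\<star>\<bar>\<close>.
\<close>

section \<open>Smooth convex functions on \<open>Rn n\<close>\<close>

text \<open>The line never leaves \<open>Rn n\<close>, so a derivative within \<open>Rn n\<close>
  restricts to an ordinary derivative in \<open>t\<close>; this opens the way to one-variable
  calculus.\<close>

lemma has_real_derivative_line:
  assumes f: "f \<in> F1 n L" and w: "w \<in> Rn n" and h: "h \<in> Rn n"
  shows "((\<lambda>t. f (w + t *\<^sub>R h)) has_real_derivative inner (grad n f (w + t *\<^sub>R h)) h) (at t)"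
proof -
  have mem: "w + t *\<^sub>R h \<in> Rn n" for t
    using w h by (simp add: subspace_add subspace_scale subspace_Rn)
  have line: "((\<lambda>t. w + t *\<^sub>R h) has_derivative (\<lambda>t. t *\<^sub>R h)) (at t)"
    by (auto intro!: derivative_eq_intros)
  have "f differentiable (at (w + t *\<^sub>R h) within Rn n)"
    using f mem by (auto simp: F1_def differentiable_on_def)
  then have "(f has_derivative (\<lambda>v. inner (grad n f (w + t *\<^sub>R h)) v))
      (at (w + t *\<^sub>R h) within range (\<lambda>t. w + t *\<^sub>R h))"
    by (intro has_derivative_subset[OF grad_works(2)]) (use mem in auto)
  from has_derivative_in_compose[OF line this] show ?thesis
    by (simp add: has_field_derivative_def mult_commute_abs)
qed

lemma grad_in_Rn: "f \<in> F1 n L \<Longrightarrow> w \<in> Rn n \<Longrightarrow> grad n f w \<in> Rn n"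
  by (rule grad_works(1)) (auto simp: F1_def differentiable_on_def)

lemma above_tangent:
  assumes f: "f \<in> F1 n L" and v: "v \<in> Rn n" and w: "w \<in> Rn n"
  shows "f w + inner (grad n f w) (v - w) \<le> f v"
proof -
  have h: "v - w \<in> Rn n"
    using v w by (simp add: subspace_diff subspace_Rn)
  have mem: "w + t *\<^sub>R (v - w) \<in> Rn n" for t
    using w h by (simp add: subspace_add subspace_scale subspace_Rn)
  let ?p = "\<lambda>t. f (w + t *\<^sub>R (v - w))"
  have cf: "convex_on (Rn n) f"
    using f by (simp add: F1_def)
  have "convex_on UNIV ?p"
  proof (rule convex_onI)
    fix t a b :: real
    assume t: "0 < t" "t < 1"
    have "w + ((1 - t) *\<^sub>R a + t *\<^sub>R b) *\<^sub>R (v - w) =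
        (1 - t) *\<^sub>R (w + a *\<^sub>R (v - w)) + t *\<^sub>R (w + b *\<^sub>R (v - w))"
      by (simp add: algebra_simps)
    then show "?p ((1 - t) *\<^sub>R a + t *\<^sub>R b) \<le> (1 - t) * ?p a + t * ?p b"
      using convex_onD[OF cf, of t "w + a *\<^sub>R (v - w)" "w + b *\<^sub>R (v - w)"] t mem by simp
  qed simp
  then have "?p 1 - ?p 0 \<ge> inner (grad n f w) (v - w) * (1 - 0)"
    by (rule convex_on_imp_above_tangent)
      (use has_real_derivative_line[OF f w h, of 0] in auto)
  then show ?thesis by simp
qed

lemma descent:
  assumes f: "f \<in> F1 n L" and w: "w \<in> Rn n" and h: "h \<in> Rn n"
  shows "f (w + h) \<le> f w + inner (grad n f w) h + L / 2 * (norm h)\<^sup>2"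
proof -
  \<comment> \<open>Subtracting the claimed quadratic bound reduces the inequality to monotonicity:
    Cauchy-Schwarz and the Lipschitz bound make the derivative of \<open>p\<close> nonpositive on
    [0, 1].\<close>
  define p where "p t = f (w + t *\<^sub>R h) - t * inner (grad n f w) h - L / 2 * t\<^sup>2 * (norm h)\<^sup>2" for t
  have "p 1 \<le> p 0"
  proof (rule DERIV_nonpos_imp_nonincreasing[where f = p and a = 0 and b = 1])
    fix t :: real
    assume t: "0 \<le> t" "t \<le> 1"
    let ?d = "inner (grad n f (w + t *\<^sub>R h)) h - inner (grad n f w) h - L * t * (norm h)\<^sup>2"
    have "(p has_real_derivative ?d) (at t)"
      unfolding p_def by (auto intro!: derivative_eq_intros has_real_derivative_line[OF f w h])
    moreover have "?d \<le> 0"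
    proof -
      have "w + t *\<^sub>R h \<in> Rn n"
        using w h by (simp add: subspace_add subspace_scale subspace_Rn)
      then have "norm (grad n f (w + t *\<^sub>R h) - grad n f w) \<le> L * norm (w + t *\<^sub>R h - w)"
        using f w unfolding F1_def by blast
      then have "norm (grad n f (w + t *\<^sub>R h) - grad n f w) * norm h \<le> L * (t * norm h) * norm h"
        using t by (intro mult_right_mono) auto
      then show ?thesis
        using norm_cauchy_schwarz[of "grad n f (w + t *\<^sub>R h) - grad n f w" h]
        by (simp add: inner_diff_left power2_eq_square mult.assoc)
    qed
    ultimately show "\<exists>d. (p has_real_derivative d) (at t) \<and> d \<le> 0" by blast
  qed simp
  then show ?thesis by (simp add: p_def)
qed

text \<open>The function \<open>f - \<langle>\<nabla>f(w), \<cdot>\<rangle>\<close> is minimal at \<open>w\<close>; compare with a gradient step from \<open>v\<close>.\<close>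

lemma above_tangent_cocoercive:
  assumes f: "f \<in> F1 n L" and L: "L > 0" and v: "v \<in> Rn n" and w: "w \<in> Rn n"
  shows "f w + inner (grad n f w) (v - w) + (norm (grad n f v - grad n f w))\<^sup>2 / (2 * L) \<le> f v"
proof -
  define d where "d = grad n f v - grad n f w"
  have d: "d \<in> Rn n"
    using f v w by (simp add: d_def grad_in_Rn subspace_diff subspace_Rn)
  have h: "(- 1 / L) *\<^sub>R d \<in> Rn n"
    using d by (intro subspace_scale subspace_Rn)
  have "f w + inner (grad n f w) (v + (- 1 / L) *\<^sub>R d - w) \<le> f (v + (- 1 / L) *\<^sub>R d)"
    by (rule above_tangent[OF f _ w]) (use v h in \<open>simp only: subspace_add subspace_Rn\<close>)
  also have "\<dots> \<le> f v + inner (grad n f v) ((- 1 / L) *\<^sub>R d) + L / 2 * (norm ((- 1 / L) *\<^sub>R d))\<^sup>2"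
    by (rule descent[OF f v h])
  finally have "f w + inner (grad n f w) (v - w) + inner d d / L \<le> f v + L / 2 * (norm d / L)\<^sup>2"
    using L by (simp add: d_def inner_diff_left inner_diff_right inner_add_right diff_divide_distrib add_divide_distrib)
  moreover have "inner d d / L - L / 2 * (norm d / L)\<^sup>2 = (norm d)\<^sup>2 / (2 * L)"
    using L by (simp add: power2_norm_eq_inner[symmetric] power_divide field_simps power2_eq_square)
  ultimately show ?thesis by (simp add: d_def)
qed

lemma grad_minimizer:
  assumes f: "f \<in> F1 n L" and z: "minimizer n f z"
  shows "grad n f z = 0"
proof -
  have zR: "z \<in> Rn n" using z by (simp add: minimizer_def)
  have g: "grad n f z \<in> Rn n" by (rule grad_in_Rn[OF f zR])
  have min: "f z \<le> f (z + t *\<^sub>R grad n f z)" for t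
    using z zR g by (simp add: minimizer_def subspace_add subspace_scale subspace_Rn)
  have "inner (grad n f z) (grad n f z) = 0"
    by (rule DERIV_local_min[where d = 1 and x = 0])
      (use has_real_derivative_line[OF f zR g, of 0] min in auto)
  then show ?thesis by simp
qed

section \<open>The energy estimate\<close>

lemma discrete_gronwall:
  fixes u h :: "nat \<Rightarrow> real"
  assumes q: "q \<ge> 0" and J: "J \<ge> 1"
    and u: "\<And>j. j \<ge> J \<Longrightarrow> u j \<ge> 0" and h: "\<And>j. h j \<ge> 0"
    and step: "\<And>j. j \<ge> J \<Longrightarrow> u (Suc j) + h (Suc j) \<le> (1 + q / (real j + 1)\<^sup>2) * u j"
    and j: "j \<ge> J"
  shows "u j + (\<Sum>i\<in>{J<..j}. h i) \<le> exp q * u J"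
proof -
  \<comment> \<open>The weight \<open>exp (q / real j)\<close> decreases fast enough to absorb the
    growth factor, as \<open>q / (j + 1)^2\<close> is at most \<open>q / j - q / (j + 1)\<close>. It
    is at least 1, so the \<open>h\<close> terms need no weight, and at \<open>J\<close> it is at
    most \<open>exp q\<close>.\<close>
  have "exp (q / real j) * u j + (\<Sum>i\<in>{J<..j}. h i) \<le> exp (q / real J) * u J"
    using j
  proof (induction j rule: dec_induct)
    case base
    then show ?case by simp
  next
    case (step j)
    have j: "j \<ge> J" "real j > 0" using step J by auto
    let ?p = "exp (q / real (Suc j))"
    have uj: "u j \<ge> 0" using u j by blast
    have "q / (real j + 1)\<^sup>2 \<le> q / real j - q / real (Suc j)"
    proof -
      have "q / real j - q / real (Suc j) = q / (real j * (real j + 1))"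
        using j by (simp add: field_simps)
      moreover have "q / (real j + 1)\<^sup>2 \<le> q / (real j * (real j + 1))"
        using j q by (intro divide_left_mono) (auto simp: power2_eq_square)
      ultimately show ?thesis by simp
    qed
    then have "1 + q / (real j + 1)\<^sup>2 \<le> exp (q / real j - q / real (Suc j))"
      using exp_ge_add_one_self[of "q / real j - q / real (Suc j)"] by linarith
    then have "?p * (1 + q / (real j + 1)\<^sup>2) \<le> ?p * exp (q / real j - q / real (Suc j))"
      by (intro mult_left_mono) auto
    then have w: "?p * (1 + q / (real j + 1)\<^sup>2) \<le> exp (q / real j)"
      by (simp flip: exp_add)
    have "1 * h (Suc j) \<le> ?p * h (Suc j)"
      by (rule mult_right_mono) (use h q in auto)
    then have "?p * u (Suc j) + h (Suc j) \<le> ?p * (u (Suc j) + h (Suc j))"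
      by (simp add: distrib_left)
    also have "\<dots> \<le> ?p * ((1 + q / (real j + 1)\<^sup>2) * u j)"
      by (intro mult_left_mono assms(5) j) auto
    also have "\<dots> \<le> exp (q / real j) * u j"
      using mult_right_mono[OF w uj] by (simp add: mult.assoc)
    finally have "?p * u (Suc j) + h (Suc j) \<le> exp (q / real j) * u j" .
    moreover have "{J<..Suc j} = insert (Suc j) {J<..j}"
      using j by auto
    ultimately show ?case
      using step.IH by simp
  qed
  moreover have "1 * u j \<le> exp (q / real j) * u j"
    by (rule mult_right_mono) (use q u j in auto)
  moreover have "exp (q / real J) * u J \<le> exp q * u J"
    using q J u[of J] by (intro mult_right_mono) (auto simp: divide_le_eq mult_le_cancel_left1)
  ultimately show ?thesis by simp
qed

lemma sum_squares_ge:
  assumes "J \<le> k"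
  shows "((real k + 1) ^ 3 - (real J + 1) ^ 3) / 7 \<le> (\<Sum>i\<in>{J<..k}. (real i)\<^sup>2)"
  using assms
proof (induction k rule: dec_induct)
  case base
  then show ?case by simp
next
  case (step k)
  have "{J<..Suc k} = insert (Suc k) {J<..k}"
    using step by auto
  \<comment> \<open>With \<open>i = Suc k\<close> the difference is \<open>3 i^2 + 3 i + 1\<close>,
    and \<open>i\<close> is at least 1; hence the 7.\<close>
  moreover have "(real (Suc k) + 1) ^ 3 - (real k + 1) ^ 3 \<le> 7 * (real (Suc k))\<^sup>2"
    by (simp add: power2_eq_square power3_eq_cube algebra_simps)
  ultimately show ?case
    using step.IH by simp
qed

text \<open>
  The step size is absorbed: \<open>G k\<close> stands for \<open>s \<nabla>f(x\<^sub>k)\<close> and \<open>F k\<close> for \<open>s (f(x\<^sub>k) - f(x\<^sup>\<star>))\<close>.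
\<close>

locale scaled_nag_c =
  fixes \<alpha> \<beta> :: real and x y G :: "nat \<Rightarrow> 'a::real_inner" and F :: "nat \<Rightarrow> real" and z :: 'a
  assumes alpha: "\<alpha> \<ge> 3" and beta: "\<beta> > 1 / 2"
    and y_0: "y 0 = x 0"
    and y_Suc: "y (Suc k) = x k - \<beta> *\<^sub>R G k"
    and x_Suc: "x (Suc k) = x k - G k + (real k / (real k + \<alpha>)) *\<^sub>R (y (Suc k) - y k)"
    and F_nonneg: "F k \<ge> 0"
    and tangent: "F k \<le> inner (G k) (x k - z)"
    and cocoercive: "F (Suc k) - F k + (norm (G (Suc k) - G k))\<^sup>2 * (\<beta>\<^sup>2 / (2 * \<beta> - 1))
      \<le> inner (G (Suc k)) (x (Suc k) - x k)"
    and lipschitz: "norm (G k) \<le> norm (x k - z)"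
begin

section \<open>One-step inequality for the energy\<close>

definition V :: "nat \<Rightarrow> 'a" where
  "V k = real k *\<^sub>R (x k - y k) + (\<alpha> - 1) *\<^sub>R (x k - z)"

text \<open>Multiplying the update by \<open>k + \<alpha>\<close> clears the momentum denominator,
  and this is exactly the coefficient of \<open>x (Suc k)\<close> in
  \<open>V (Suc k)\<close>.\<close>

lemma V_Suc: "V (Suc k) = V k - (real k + \<alpha> - \<beta>) *\<^sub>R G k"
proof -
  have "(real k + \<alpha>) *\<^sub>R (x (Suc k) - x k + G k) = real k *\<^sub>R (y (Suc k) - y k)"
    using alpha by (simp add: x_Suc)
  then have eq: "(real k + \<alpha>) *\<^sub>R x (Suc k) =
      (real k + \<alpha>) *\<^sub>R x k - (real k + \<alpha>) *\<^sub>R G k + real k *\<^sub>R (y (Suc k) - y k)"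
    by (simp add: algebra_simps)
  have "V (Suc k) = (real k + \<alpha>) *\<^sub>R x (Suc k) - (real k + 1) *\<^sub>R y (Suc k) - (\<alpha> - 1) *\<^sub>R z"
    by (simp add: V_def algebra_simps)
  also have "\<dots> = V k - (real k + \<alpha> - \<beta>) *\<^sub>R G k"
    unfolding eq V_def y_Suc by (simp add: algebra_simps)
  finally show ?thesis .
qed

text \<open>\<open>V\<close> runs one index ahead of \<open>F\<close>, so that the next change of
  \<open>V\<close> involves \<open>G (Suc j)\<close>, the gradient against which
  \<open>F (Suc j) - F j\<close> is estimated.\<close>

definition E :: "nat \<Rightarrow> real" where
  "E j = (real j + \<alpha> - \<beta>) * (real j + \<alpha> - 1) * F j + (norm (V (Suc j)))\<^sup>2 / 2"

text \<open>The bound on \<open>s L\<close> is what lets the cocoercivity term pay for replacing \<open>G k\<close> by \<open>G (Suc k)\<close>.\<close>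

lemma inner_G_G:
  "(\<beta> / 2 + 1 / 4) * (norm (G (Suc k)))\<^sup>2 \<le>
    \<beta> * inner (G (Suc k)) (G k) + (norm (G (Suc k) - G k))\<^sup>2 * (\<beta>\<^sup>2 / (2 * \<beta> - 1))"
proof -
  define a where "a = 2 * \<beta> - 1"
  define D where "D = G (Suc k) - G k"
  have a: "a > 0" using beta by (simp add: a_def)
  \<comment> \<open>The square is weighted so that \<open>D\<close> costs exactly what
    \<open>cocoercive\<close> supplies, while \<open>G (Suc k)\<close> loses only
    \<open>a / 4\<close>. The remainder \<open>\<beta> - a / 4 = \<beta> / 2 + 1 / 4\<close> still
    exceeds 1/2.\<close>
  have "0 \<le> (norm ((2 * \<beta>) *\<^sub>R D - a *\<^sub>R G (Suc k)))\<^sup>2 / (4 * a)"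
    using a by simp
  also have "\<dots> = (norm D)\<^sup>2 * (\<beta>\<^sup>2 / a) - \<beta> * inner (G (Suc k)) D + a / 4 * (norm (G (Suc k)))\<^sup>2"
    using a unfolding power2_norm_eq_inner
    by (simp add: inner_diff_left inner_diff_right inner_commute field_simps power2_eq_square)
  finally have "\<beta> * inner (G (Suc k)) D - a / 4 * (norm (G (Suc k)))\<^sup>2 \<le> (norm D)\<^sup>2 * (\<beta>\<^sup>2 / a)"
    by linarith
  moreover have "\<beta> * inner (G (Suc k)) (G k) = \<beta> * (norm (G (Suc k)))\<^sup>2 - \<beta> * inner (G (Suc k)) D"
    by (simp add: D_def inner_diff_right power2_norm_eq_inner right_diff_distrib)
  moreover have "(\<beta> / 2 + 1 / 4) * (norm (G (Suc k)))\<^sup>2 =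
      \<beta> * (norm (G (Suc k)))\<^sup>2 - a / 4 * (norm (G (Suc k)))\<^sup>2"
    by (simp add: a_def field_simps)
  ultimately show ?thesis
    unfolding D_def[symmetric] a_def[symmetric] by linarith
qed

text \<open>The two summands of \<open>V (Suc k)\<close> are treated separately:
  \<open>x - y\<close> equals the last increment of \<open>x\<close> plus
  \<open>\<beta> *\<^sub>R G k\<close>, handled by \<open>cocoercive\<close> and
  \<open>inner_G_G\<close>, and \<open>x - z\<close> is handled by \<open>tangent\<close>.\<close>

lemma inner_G_V:
  "(real k + 1) * (F (Suc k) - F k) + (real k + 1) * (\<beta> / 2 + 1 / 4) * (norm (G (Suc k)))\<^sup>2
    + (\<alpha> - 1) * F (Suc k) \<le> inner (G (Suc k)) (V (Suc k))"
proof -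
  have "F (Suc k) - F k + (\<beta> / 2 + 1 / 4) * (norm (G (Suc k)))\<^sup>2
      \<le> inner (G (Suc k)) (x (Suc k) - y (Suc k))"
    using inner_G_G[of k] cocoercive[of k]
    by (simp add: y_Suc inner_diff_right inner_add_right)
  then have "(real k + 1) * (F (Suc k) - F k + (\<beta> / 2 + 1 / 4) * (norm (G (Suc k)))\<^sup>2)
      \<le> (real k + 1) * inner (G (Suc k)) (x (Suc k) - y (Suc k))"
    by (intro mult_left_mono) auto
  moreover have "(\<alpha> - 1) * F (Suc k) \<le> (\<alpha> - 1) * inner (G (Suc k)) (x (Suc k) - z)"
    using alpha tangent by (intro mult_left_mono) auto
  ultimately show ?thesis
    by (simp add: V_def inner_add_right algebra_simps)
qed

lemma E_Suc:
  assumes T: "real j + 1 + \<alpha> - \<beta> \<ge> 0"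
  shows "E (Suc j) + (real j + 1 + \<alpha> - \<beta>) * ((real j + 1) * (\<beta> / 2 + 1 / 4) - (real j + 1 + \<alpha> - \<beta>) / 2)
      * (norm (G (Suc j)))\<^sup>2
    \<le> E j + \<bar>\<alpha> - \<beta> - 1\<bar> * (\<alpha> - 2) * F j"
proof -
  define t where "t = real j + 1 + \<alpha> - \<beta>"
  define N where "N = (norm (G (Suc j)))\<^sup>2"
  have "V (Suc (Suc j)) = V (Suc j) - t *\<^sub>R G (Suc j)"
    by (simp add: V_Suc[of "Suc j"] t_def)
  then have "(norm (V (Suc (Suc j))))\<^sup>2 = (norm (V (Suc j)))\<^sup>2 - 2 * t * inner (G (Suc j)) (V (Suc j)) + t\<^sup>2 * N"
    unfolding N_def power2_norm_eq_inner
    by (simp add: inner_diff_left inner_diff_right inner_commute power2_eq_square)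
  moreover have "t * ((real j + 1) * (F (Suc j) - F j) + (real j + 1) * (\<beta> / 2 + 1 / 4) * N
    + (\<alpha> - 1) * F (Suc j)) \<le> t * inner (G (Suc j)) (V (Suc j))"
    using inner_G_V[of j] T unfolding N_def t_def by (intro mult_left_mono) auto
  moreover have "E (Suc j) = t * (real j + \<alpha>) * F (Suc j) + (norm (V (Suc (Suc j))))\<^sup>2 / 2"
    by (simp add: E_def t_def add_ac)
  moreover have "E j = (t - 1) * (real j + \<alpha> - 1) * F j + (norm (V (Suc j)))\<^sup>2 / 2"
    by (simp add: E_def t_def)
  \<comment> \<open>The \<open>F (Suc j)\<close> terms cancel, since
    \<open>(j + 1) + (\<alpha> - 1) = j + \<alpha>\<close>; the loss \<open>t / 2\<close> comes from
    the expanded square.\<close>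
  ultimately have "E (Suc j) + t * ((real j + 1) * (\<beta> / 2 + 1 / 4) - t / 2) * N
    \<le> E j + (t * (real j + 1) - (t - 1) * (real j + \<alpha> - 1)) * F j"
    by (simp add: algebra_simps power2_eq_square)
  \<comment> \<open>The only part growing with \<open>j\<close> carries the factor
    \<open>3 - \<alpha>\<close>, which is nonpositive; the rest is constant in
    \<open>j\<close>.\<close>
  also have "t * (real j + 1) - (t - 1) * (real j + \<alpha> - 1)
      = (real j + 1) * (3 - \<alpha>) - (\<alpha> - \<beta> - 1) * (\<alpha> - 2)"
    by (simp add: t_def algebra_simps)
  also have "E j + \<dots> * F j \<le> E j + \<bar>\<alpha> - \<beta> - 1\<bar> * (\<alpha> - 2) * F j"
  proof -
    have "(real j + 1) * (3 - \<alpha>) \<le> 0"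
      using alpha by (intro mult_nonneg_nonpos) auto
    moreover have "- (\<alpha> - \<beta> - 1) * (\<alpha> - 2) \<le> \<bar>\<alpha> - \<beta> - 1\<bar> * (\<alpha> - 2)"
      using alpha by (intro mult_right_mono) auto
    ultimately have "(real j + 1) * (3 - \<alpha>) - (\<alpha> - \<beta> - 1) * (\<alpha> - 2) \<le> \<bar>\<alpha> - \<beta> - 1\<bar> * (\<alpha> - 2)"
      unfolding mult_minus_left by linarith
    then show ?thesis
      using F_nonneg[of j] by (intro add_left_mono mult_right_mono)
  qed
  finally show ?thesis by (simp add: N_def t_def)
qed

section \<open>Exponential bounds for the initial steps\<close>

text \<open>Momentum uses the previous \<open>y\<close>, so \<open>x\<close> and \<open>y\<close>
  are bounded together. Each step costs at most a factor 2 for \<open>x k - z - G k\<close> plus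
  \<open>2 + \<beta>\<close> for the momentum.\<close>

lemma crude_bound:
  "norm (x k - z) \<le> (4 + \<beta>) ^ k * norm (x 0 - z) \<and> norm (y k - z) \<le> (4 + \<beta>) ^ k * norm (x 0 - z)"
proof (induction k)
  case 0
  then show ?case by (simp add: y_0)
next
  case (Suc k)
  define D where "D = (4 + \<beta>) ^ k * norm (x 0 - z)"
  have D: "norm (x k - z) \<le> D" "norm (y k - z) \<le> D" "norm (G k) \<le> D"
    using Suc lipschitz[of k] by (auto simp: D_def)
  have D0: "D \<ge> 0" using D(1) norm_ge_zero order_trans by blast
  have y: "norm (y (Suc k) - z) \<le> (1 + \<beta>) * D"
  proof -
    have "norm (y (Suc k) - z) = norm ((x k - z) - \<beta> *\<^sub>R G k)"
      by (simp add: y_Suc algebra_simps)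
    also have "\<dots> \<le> norm (x k - z) + \<beta> * norm (G k)"
      using norm_triangle_ineq4[of "x k - z" "\<beta> *\<^sub>R G k"] beta by simp
    also have "\<dots> \<le> D + \<beta> * D"
      using D beta by (intro add_mono mult_left_mono) auto
    finally show ?thesis by (simp add: algebra_simps)
  qed
  have "norm (x (Suc k) - z) \<le> (4 + \<beta>) * D"
  proof -
    define r where "r = real k / (real k + \<alpha>)"
    have r: "0 \<le> r" "r \<le> 1"
      using alpha by (auto simp: r_def)
    have "norm (x (Suc k) - z) = norm ((x k - z) - G k + r *\<^sub>R (y (Suc k) - y k))"
      by (simp add: x_Suc r_def algebra_simps)
    also have "\<dots> \<le> norm ((x k - z) - G k) + norm (r *\<^sub>R (y (Suc k) - y k))"
      by (rule norm_triangle_ineq)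
    also have "norm ((x k - z) - G k) \<le> D + D"
      using norm_triangle_ineq4[of "x k - z" "G k"] D by linarith
    also have "norm (r *\<^sub>R (y (Suc k) - y k)) \<le> 1 * norm (y (Suc k) - y k)"
      using r by (simp add: mult_left_le_one_le)
    also have "1 * norm (y (Suc k) - y k) \<le> (1 + \<beta>) * D + D"
      using norm_triangle_ineq4[of "y (Suc k) - z" "y k - z"] y D by simp
    finally show ?thesis by (simp add: algebra_simps)
  qed
  moreover have "(1 + \<beta>) * D \<le> (4 + \<beta>) * D"
    using D0 by (intro mult_right_mono) auto
  ultimately show ?case
    using y by (simp add: D_def mult.assoc)
qed

lemma crude_F: "F k \<le> ((4 + \<beta>) ^ k)\<^sup>2 * (norm (x 0 - z))\<^sup>2"
proof -
  have "F k \<le> norm (G k) * norm (x k - z)"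
    using tangent norm_cauchy_schwarz order_trans by blast
  also have "\<dots> \<le> norm (x k - z) * norm (x k - z)"
    using lipschitz by (intro mult_right_mono) auto
  also have "\<dots> \<le> ((4 + \<beta>) ^ k * norm (x 0 - z))\<^sup>2"
    using crude_bound[of k] by (auto simp: power2_eq_square intro!: mult_mono')
  finally show ?thesis by (simp add: power_mult_distrib)
qed

lemma crude_V: "(norm (V k))\<^sup>2 \<le> ((2 * real k + \<alpha> - 1) * (4 + \<beta>) ^ k)\<^sup>2 * (norm (x 0 - z))\<^sup>2"
proof -
  define D where "D = (4 + \<beta>) ^ k * norm (x 0 - z)"
  have D: "norm (x k - z) \<le> D" "norm (y k - z) \<le> D"
    using crude_bound[of k] by (auto simp: D_def)
  have "norm (V k) \<le> real k * norm (x k - y k) + (\<alpha> - 1) * norm (x k - z)"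
    using alpha unfolding V_def by (intro norm_triangle_le) auto
  also have "\<dots> \<le> real k * (2 * D) + (\<alpha> - 1) * D"
    using D alpha norm_triangle_ineq4[of "x k - z" "y k - z"]
    by (intro add_mono mult_left_mono) auto
  finally have "norm (V k) \<le> (2 * real k + \<alpha> - 1) * D"
    by (simp add: algebra_simps)
  then have "(norm (V k))\<^sup>2 \<le> ((2 * real k + \<alpha> - 1) * D)\<^sup>2"
    by (intro power_mono) auto
  then show ?thesis by (simp add: D_def power_mult_distrib mult_ac)
qed

end

section \<open>Uniform rates for the scaled iteration\<close>

lemma scaled_nag_c_rates:
  fixes \<alpha> \<beta> :: real
  assumes alpha: "\<alpha> \<ge> 3" and beta: "\<beta> > 1 / 2"
  shows "\<exists>C>0. \<forall>(x :: nat \<Rightarrow> 'a::real_inner) y G F z. scaled_nag_c \<alpha> \<beta> x y G F z \<longrightarrow>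
    (\<forall>k. Min ((\<lambda>i. (norm (G i))\<^sup>2) ` {0..k}) * (real k + 1) ^ 3 \<le> C * (norm (x 0 - z))\<^sup>2) \<and>
    (\<forall>k. F k * (real k + 1)\<^sup>2 \<le> C * (norm (x 0 - z))\<^sup>2)"
proof -
  define m where "m = \<alpha> - \<beta>"
  \<comment> \<open>The surplus of \<open>\<beta> / 2 + 1 / 4\<close> over the 1/2 lost to the
    expanded square.\<close>
  define e where "e = \<beta> / 2 - 1 / 4"
  define Q where "Q = \<bar>m - 1\<bar> * (\<alpha> - 2)"
  have e: "e > 0" using beta by (simp add: e_def)
  have Q: "Q \<ge> 0" using alpha by (simp add: Q_def)
  \<comment> \<open>From \<open>J\<close> on, \<open>j + m\<close> is at least
    \<open>(j + 1) / 2\<close>, and the loss \<open>m / 2\<close> uses up at most half of the gain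
    \<open>(j + 1) * e\<close>.\<close>
  obtain J :: nat where J: "real J \<ge> max 1 (max (2 * \<bar>m\<bar> + 2) (\<bar>m\<bar> / e))"
    using real_arch_simple by blast
  \<comment> \<open>The exponent is \<open>Suc J\<close> because \<open>E J\<close> contains
    \<open>V (Suc J)\<close>.\<close>
  define D where "D = (4 + \<beta>) ^ Suc J"
  define B where "B = (real J + m) * (real J + \<alpha> - 1) * D\<^sup>2 + ((2 * real J + \<alpha> + 1) * D)\<^sup>2 / 2"
  define M where "M = exp (2 * Q) * B"
  \<comment> \<open>The first summand serves the indices up to \<open>J\<close>, the second the
    function values beyond, the third the gradients; 28 is 4 from \<open>h\<close> times 7 from
    \<open>sum_squares_ge\<close>.\<close>
  define C where "C = (real J + 1) ^ 3 * D\<^sup>2 + 2 * M + 28 * M / e"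
  have D1: "D \<ge> 1"
    unfolding D_def using beta by (intro one_le_power) auto
  have Jm: "real J \<ge> 1" "real J \<ge> 2 * \<bar>m\<bar> + 2" "real J \<ge> \<bar>m\<bar> / e"
    using J by auto
  have B: "B \<ge> 0"
  proof -
    have "real J + m \<ge> 0" using Jm(2) by linarith
    then show ?thesis
      unfolding B_def using Jm(1) alpha by auto
  qed
  have M: "M \<ge> 0" using B by (simp add: M_def)
  have C: "C > 0"
  proof -
    have "(real J + 1) ^ 3 * D\<^sup>2 > 0" using D1 by simp
    moreover have "28 * M / e \<ge> 0" using M e by simp
    ultimately show ?thesis using M by (simp add: C_def)
  qed
  have C1: "(real J + 1) ^ 3 * D\<^sup>2 \<le> C" and C2: "2 * M \<le> C"
    and C3: "(real J + 1) ^ 3 + 28 * M / e \<le> C"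
  proof -
    have "(real J + 1) ^ 3 * 1 \<le> (real J + 1) ^ 3 * D\<^sup>2"
      using D1 by (intro mult_left_mono) auto
    moreover have "28 * M / e \<ge> 0" using M e by simp
    moreover have "(real J + 1) ^ 3 \<ge> 0" by simp
    ultimately show "(real J + 1) ^ 3 * D\<^sup>2 \<le> C" "2 * M \<le> C"
        "(real J + 1) ^ 3 + 28 * M / e \<le> C"
      using M unfolding C_def by linarith+
  qed
  have D_mono: "((4 + \<beta>) ^ k)\<^sup>2 \<le> D\<^sup>2" if "k \<le> Suc J" for k
    unfolding D_def using that beta by (intro power_mono power_increasing) auto
  have rates: "Min ((\<lambda>i. (norm (G i))\<^sup>2) ` {0..k}) * (real k + 1) ^ 3 \<le> C * (norm (x 0 - z))\<^sup>2
      \<and> F k * (real k + 1)\<^sup>2 \<le> C * (norm (x 0 - z))\<^sup>2"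
    if "scaled_nag_c \<alpha> \<beta> x y G F z" for x y G :: "nat \<Rightarrow> 'a" and F z k
  proof -
    interpret scaled_nag_c \<alpha> \<beta> x y G F z by fact
    define R where "R = (norm (x 0 - z))\<^sup>2"
    have R: "R \<ge> 0" by (simp add: R_def)
    define h where "h i = e / 4 * ((real i)\<^sup>2 * (norm (G i))\<^sup>2)" for i
    have Fcoef: "(real j + 1)\<^sup>2 / 2 \<le> (real j + m) * (real j + \<alpha> - 1)" if "j \<ge> J" for j
    proof -
      have "(real j + 1) / 2 * (real j + 1) \<le> (real j + m) * (real j + \<alpha> - 1)"
        using Jm that alpha by (intro mult_mono) auto
      then show ?thesis by (simp add: power2_eq_square)
    qed
    have EF: "(real j + 1)\<^sup>2 / 2 * F j \<le> E j" if "j \<ge> J" for j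
      using mult_right_mono[OF Fcoef[OF that] F_nonneg[of j]]
      by (simp add: E_def m_def add_diff_eq add_increasing2)
    have E0: "E j \<ge> 0" if "j \<ge> J" for j
      using EF[OF that] F_nonneg[of j] by (intro order_trans[OF _ EF[OF that]]) auto
    have step: "E (Suc j) + h (Suc j) \<le> (1 + 2 * Q / (real j + 1)\<^sup>2) * E j" if j: "j \<ge> J" for j
    proof -
      define t where "t = real j + 1 + m"
      have t: "t \<ge> (real j + 1) / 2"
        using Jm j by (simp add: t_def)
      have "real j + 1 \<ge> \<bar>m\<bar> / e" using Jm j by simp
      then have "(real j + 1) * e \<ge> \<bar>m\<bar>"
        using e by (simp add: divide_le_eq)
      then have "(real j + 1) * e / 2 \<le> (real j + 1) * e - m / 2"
        by linarith
      also have "\<dots> = (real j + 1) * (\<beta> / 2 + 1 / 4) - t / 2"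
        by (simp add: t_def e_def algebra_simps)
      finally have "(real j + 1) / 2 * ((real j + 1) * e / 2) \<le>
          t * ((real j + 1) * (\<beta> / 2 + 1 / 4) - t / 2)"
        using t e by (intro mult_mono) auto
      then have "(real j + 1) / 2 * ((real j + 1) * e / 2) * (norm (G (Suc j)))\<^sup>2 \<le>
          t * ((real j + 1) * (\<beta> / 2 + 1 / 4) - t / 2) * (norm (G (Suc j)))\<^sup>2"
        by (intro mult_right_mono) auto
      moreover have "h (Suc j) = (real j + 1) / 2 * ((real j + 1) * e / 2) * (norm (G (Suc j)))\<^sup>2"
        by (simp add: h_def power2_eq_square add_ac)
      moreover have "E (Suc j) + t * ((real j + 1) * (\<beta> / 2 + 1 / 4) - t / 2) * (norm (G (Suc j)))\<^sup>2
          \<le> E j + Q * F j"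
        using E_Suc[of j] t by (simp add: t_def Q_def m_def add_diff_eq)
      \<comment> \<open>\<open>EF\<close> bounds the leftover function value by the energy over a
        quadratic, which is the summable growth factor that \<open>discrete_gronwall\<close>
        accepts.\<close>
      moreover have "Q * F j \<le> 2 * Q / (real j + 1)\<^sup>2 * E j"
      proof -
        have "2 * Q / (real j + 1)\<^sup>2 * ((real j + 1)\<^sup>2 / 2 * F j) \<le> 2 * Q / (real j + 1)\<^sup>2 * E j"
          using Q by (intro mult_left_mono EF j) auto
        then show ?thesis by simp
      qed
      ultimately show ?thesis by (simp add: distrib_right)
    qed
    have h0: "h i \<ge> 0" for i using e by (simp add: h_def)
    have EJ: "E J \<le> B * R"
    proof -
      have "(real J + m) * (real J + \<alpha> - 1) * F J \<le> (real J + m) * (real J + \<alpha> - 1) * (D\<^sup>2 * R)"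
        using crude_F[of J] mult_right_mono[OF D_mono[of J] R] Jm alpha
        by (intro mult_left_mono mult_nonneg_nonneg) (auto simp: R_def)
      moreover have "(norm (V (Suc J)))\<^sup>2 \<le> ((2 * real J + \<alpha> + 1) * D)\<^sup>2 * R"
        using crude_V[of "Suc J"] by (simp add: R_def D_def add_ac)
      ultimately show ?thesis
        by (simp add: E_def B_def m_def algebra_simps)
    qed
    have energy: "E j + (\<Sum>i\<in>{J<..j}. h i) \<le> M * R" if "j \<ge> J" for j
    proof -
      have "E j + (\<Sum>i\<in>{J<..j}. h i) \<le> exp (2 * Q) * E J"
        by (rule discrete_gronwall) (use Q Jm E0 h0 step that in auto)
      also have "\<dots> \<le> exp (2 * Q) * (B * R)"
        using EJ by simp
      finally show ?thesis by (simp add: M_def mult.assoc)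
    qed
    have "F k * (real k + 1)\<^sup>2 \<le> C * R"
    proof (cases "k \<ge> J")
      case True
      have "(\<Sum>i\<in>{J<..k}. h i) \<ge> 0"
        using h0 by (intro sum_nonneg)
      then have "F k * (real k + 1)\<^sup>2 \<le> 2 * M * R"
        using EF[OF True] energy[OF True] by (simp add: mult.commute[of "F k"])
      also have "\<dots> \<le> C * R"
        using C2 R by (rule mult_right_mono)
      finally show ?thesis .
    next
      case False
      have "F k * (real k + 1)\<^sup>2 \<le> (D\<^sup>2 * R) * (real J + 1) ^ 3"
      proof (rule mult_mono)
        show "F k \<le> D\<^sup>2 * R"
          using crude_F[of k] mult_right_mono[OF D_mono[of k] R] False by (auto simp: R_def)
        have "(real k + 1)\<^sup>2 \<le> (real J + 1)\<^sup>2"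
          using False by (intro power_mono) auto
        also have "\<dots> \<le> (real J + 1) ^ 3"
          by (rule power_increasing) auto
        finally show "(real k + 1)\<^sup>2 \<le> (real J + 1) ^ 3" .
      qed (use R in auto)
      also have "\<dots> \<le> C * R"
        using mult_right_mono[OF C1 R] by (simp add: mult_ac)
      finally show ?thesis .
    qed
    moreover have "Min ((\<lambda>i. (norm (G i))\<^sup>2) ` {0..k}) * (real k + 1) ^ 3 \<le> C * R"
    proof -
      define mu where "mu = Min ((\<lambda>i. (norm (G i))\<^sup>2) ` {0..k})"
      have mu_le: "mu \<le> (norm (G i))\<^sup>2" if "i \<le> k" for i
        unfolding mu_def using that by (intro Min_le) auto
      have mu0: "mu \<ge> 0"
        unfolding mu_def by (subst Min_ge_iff) auto
      have "mu \<le> R"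
        using order_trans[OF mu_le[of 0] power_mono[OF lipschitz[of 0]]] by (simp add: R_def)
      then have muJ: "mu * (real J + 1) ^ 3 \<le> (real J + 1) ^ 3 * R"
        unfolding mult.commute[of mu] by (intro mult_left_mono) auto
      \<comment> \<open>The energy controls gradients only beyond \<open>J\<close>, hence the
        difference of cubes; \<open>muJ\<close> pays for the missing part through the gradient at
        index 0.\<close>
      have "mu * ((real k + 1) ^ 3 - (real J + 1) ^ 3) \<le> 28 * M / e * R"
      proof (cases "k \<ge> J")
        case True
        have "e / 4 * (mu * (((real k + 1) ^ 3 - (real J + 1) ^ 3) / 7))
            \<le> e / 4 * (mu * (\<Sum>i\<in>{J<..k}. (real i)\<^sup>2))"
          using e mu0 sum_squares_ge[OF True] by (intro mult_left_mono) auto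
        also have "\<dots> = (\<Sum>i\<in>{J<..k}. e / 4 * ((real i)\<^sup>2 * mu))"
          by (simp add: sum_distrib_left mult_ac)
        also have "\<dots> \<le> (\<Sum>i\<in>{J<..k}. h i)"
          unfolding h_def using e mu_le by (intro sum_mono mult_left_mono) auto
        also have "\<dots> \<le> M * R"
          using energy[OF True] E0[OF True] by linarith
        finally show ?thesis
          using e by (simp add: field_simps)
      next
        case False
        then have "(real k + 1) ^ 3 \<le> (real J + 1) ^ 3"
          by (intro power_mono) auto
        then have "mu * ((real k + 1) ^ 3 - (real J + 1) ^ 3) \<le> 0"
          using mu0 by (intro mult_nonneg_nonpos) auto
        also have "0 \<le> 28 * M / e * R" using M e R by simp
        finally show ?thesis .
      qed
      then have "mu * (real k + 1) ^ 3 \<le> ((real J + 1) ^ 3 + 28 * M / e) * R"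
        using muJ unfolding right_diff_distrib distrib_right by linarith
      also have "\<dots> \<le> C * R"
        using C3 R by (rule mult_right_mono)
      finally show ?thesis by (simp add: mu_def)
    qed
    ultimately show ?thesis by (simp add: R_def)
  qed
  show ?thesis
    using C rates by blast
qed

section \<open>From NAG-C to the scaled iteration\<close>

lemma scaled_nag_c_NAG_C:
  fixes \<alpha> \<beta> L s :: real
  assumes alpha: "\<alpha> \<ge> 3" and beta: "\<beta> > 1 / 2" and L: "L > 0" and f: "f \<in> F1 n L"
    and z: "minimizer n f z" and x0: "x0 \<in> Rn n"
    and s: "0 < s" "s \<le> (2 * \<beta> - 1) / (2 * \<beta>\<^sup>2) / L"
    and nag: "NAG_C n f \<alpha> \<beta> s x0 x y"
  shows "scaled_nag_c \<alpha> \<beta> x y (\<lambda>k. s *\<^sub>R grad n f (x k)) (\<lambda>k. s * (f (x k) - f z)) z"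
proof -
  have y_Suc: "y (Suc k) = x k - (\<beta> * s) *\<^sub>R grad n f (x k)"
    and x_Suc: "x (Suc k) = x k - s *\<^sub>R grad n f (x k) +
        (real k / (real k + \<alpha>)) *\<^sub>R (y (Suc k) - y k)" for k
    using nag by (auto simp: NAG_C_def)
  have zR: "z \<in> Rn n" using z by (simp add: minimizer_def)
  have mem: "x k \<in> Rn n \<and> y k \<in> Rn n" for k
  proof (induction k)
    case 0
    then show ?case using nag x0 by (simp add: NAG_C_def)
  next
    case (Suc k)
    then have g: "grad n f (x k) \<in> Rn n" using grad_in_Rn[OF f] by blast
    have "y (Suc k) \<in> Rn n"
      unfolding y_Suc using Suc g by (intro subspace_diff subspace_scale subspace_Rn) auto
    moreover from this have "x (Suc k) \<in> Rn n"
      unfolding x_Suc using Suc g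
      by (intro subspace_add subspace_diff subspace_scale subspace_Rn) auto
    ultimately show ?case by simp
  qed
  then have xR: "x k \<in> Rn n" for k by blast
  have sL: "s * L \<le> (2 * \<beta> - 1) / (2 * \<beta>\<^sup>2)"
    using s(2) unfolding pos_le_divide_eq[OF L] .
  \<comment> \<open>This turns the step-size bound into \<open>s * L \<le> 1\<close>, so that
    \<open>G\<close> is bounded by the distance to \<open>z\<close> with constant 1.\<close>
  have b: "(2 * \<beta> - 1) / (2 * \<beta>\<^sup>2) \<le> 1"
  proof -
    have "2 * \<beta> - 1 \<le> 2 * \<beta>\<^sup>2"
      using zero_le_power2[of "\<beta> - 1"] zero_le_power2[of \<beta>] unfolding power2_diff by (simp, linarith)
    then show ?thesis using beta by simp
  qed
  show ?thesis
  proof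
    fix k
    show "y (Suc k) = x k - \<beta> *\<^sub>R s *\<^sub>R grad n f (x k)"
      by (simp add: y_Suc)
    show "0 \<le> s * (f (x k) - f z)"
      using z xR s by (simp add: minimizer_def)
    have "f (x k) - f z \<le> inner (grad n f (x k)) (x k - z)"
      using above_tangent[OF f zR xR[of k]] by (simp add: inner_diff_right)
    then show "s * (f (x k) - f z) \<le> inner (s *\<^sub>R grad n f (x k)) (x k - z)"
      using s by simp
    have "norm (grad n f (x k) - grad n f z) \<le> L * norm (x k - z)"
      using f xR zR unfolding F1_def by blast
    then have "s * norm (grad n f (x k)) \<le> (s * L) * norm (x k - z)"
      using s grad_minimizer[OF f z] by simp
    also have "\<dots> \<le> 1 * norm (x k - z)"
      using sL b by (intro mult_right_mono) auto
    finally show "norm (s *\<^sub>R grad n f (x k)) \<le> norm (x k - z)"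
      using s by simp
    define d where "d = norm (grad n f (x (Suc k)) - grad n f (x k))"
    \<comment> \<open>The base point is the newer iterate, so that the new gradient appears in the
      inner product.\<close>
    have "f (x (Suc k)) + inner (grad n f (x (Suc k))) (x k - x (Suc k)) + d\<^sup>2 / (2 * L) \<le> f (x k)"
      using above_tangent_cocoercive[OF f L xR[of k] xR[of "Suc k"]]
      by (simp add: d_def norm_minus_commute)
    then have "s * (f (x (Suc k)) - f (x k) + d\<^sup>2 / (2 * L)) \<le>
        s * inner (grad n f (x (Suc k))) (x (Suc k) - x k)"
      using s by (intro mult_left_mono) (auto simp: inner_diff_right)
    \<comment> \<open>The step-size constant is fixed here: the bound on \<open>s\<close> says
      exactly that \<open>s * (\<beta>\<^sup>2 / (2 * \<beta> - 1))\<close> is at most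
      \<open>1 / (2 * L)\<close>.\<close>
    moreover have "(s * d)\<^sup>2 * (\<beta>\<^sup>2 / (2 * \<beta> - 1)) \<le> s * (d\<^sup>2 / (2 * L))"
    proof -
      have "s * L * (2 * \<beta>\<^sup>2) \<le> 2 * \<beta> - 1"
        using sL beta by (subst (asm) pos_le_divide_eq) auto
      then have "s * (\<beta>\<^sup>2 / (2 * \<beta> - 1)) \<le> 1 / (2 * L)"
        using L beta by (simp add: field_simps)
      then have "s * d\<^sup>2 * (s * (\<beta>\<^sup>2 / (2 * \<beta> - 1))) \<le> s * d\<^sup>2 * (1 / (2 * L))"
        using s by (intro mult_left_mono) auto
      then show ?thesis by (simp add: power2_eq_square mult_ac)
    qed
    ultimately show "s * (f (x (Suc k)) - f z) - s * (f (x k) - f z) +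
        (norm (s *\<^sub>R grad n f (x (Suc k)) - s *\<^sub>R grad n f (x k)))\<^sup>2 * (\<beta>\<^sup>2 / (2 * \<beta> - 1))
        \<le> inner (s *\<^sub>R grad n f (x (Suc k))) (x (Suc k) - x k)"
      using s by (simp add: d_def algebra_simps flip: scaleR_diff_right)
  qed (use alpha beta nag in \<open>auto simp: NAG_C_def\<close>)
qed

theorem theorem8:
  fixes \<alpha> \<beta> :: real
  assumes "\<alpha> \<ge> 3" and "\<beta> > 1 / 2"
  shows "\<exists>c>0. \<exists>C>0. \<forall>(n::nat) (L::real) f xstar x0 (s::real) x y.
    L > 0 \<longrightarrow> f \<in> F1 n L \<longrightarrow> minimizer n f xstar \<longrightarrow> x0 \<in> Rn n \<longrightarrow>
    0 < s \<longrightarrow> s \<le> c / L \<longrightarrow> NAG_C n f \<alpha> \<beta> s x0 x y \<longrightarrow>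
      (\<forall>k. Min ((\<lambda>i. (norm (grad n f (x i)))\<^sup>2) ` {0..k})
             \<le> C * (norm (x0 - xstar))\<^sup>2 / (s\<^sup>2 * (real k + 1) ^ 3)) \<and>
      (\<forall>k. f (x k) - f xstar \<le> C * (norm (x0 - xstar))\<^sup>2 / (s * (real k + 1)\<^sup>2))"
proof -
  obtain C where C: "C > 0" and rates: "\<forall>(x :: nat \<Rightarrow> fin_seq) y G F z. scaled_nag_c \<alpha> \<beta> x y G F z \<longrightarrow>
    (\<forall>k. Min ((\<lambda>i. (norm (G i))\<^sup>2) ` {0..k}) * (real k + 1) ^ 3 \<le> C * (norm (x 0 - z))\<^sup>2) \<and>
    (\<forall>k. F k * (real k + 1)\<^sup>2 \<le> C * (norm (x 0 - z))\<^sup>2)"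
    using scaled_nag_c_rates[OF assms] by blast
  have c: "(2 * \<beta> - 1) / (2 * \<beta>\<^sup>2) > 0"
    using assms by simp
  have "Min ((\<lambda>i. (norm (grad n f (x i)))\<^sup>2) ` {0..k}) \<le> C * (norm (x0 - z))\<^sup>2 / (s\<^sup>2 * (real k + 1) ^ 3)
      \<and> f (x k) - f z \<le> C * (norm (x0 - z))\<^sup>2 / (s * (real k + 1)\<^sup>2)"
    if "L > 0" "f \<in> F1 n L" "minimizer n f z" "x0 \<in> Rn n"
      "0 < s" "s \<le> (2 * \<beta> - 1) / (2 * \<beta>\<^sup>2) / L" "NAG_C n f \<alpha> \<beta> s x0 x y"
    for n L f z x0 s x y k
  proof -
    have x0: "x 0 = x0" using that by (simp add: NAG_C_def)
    let ?A = "(\<lambda>i. (norm (grad n f (x i)))\<^sup>2) ` {0..k}"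
    have r: "Min ((\<lambda>i. (norm (s *\<^sub>R grad n f (x i)))\<^sup>2) ` {0..k}) * (real k + 1) ^ 3 \<le> C * (norm (x0 - z))\<^sup>2"
        "s * (f (x k) - f z) * (real k + 1)\<^sup>2 \<le> C * (norm (x0 - z))\<^sup>2"
      using rates scaled_nag_c_NAG_C[OF assms that] unfolding x0[symmetric] by blast+
    \<comment> \<open>Undoing the scaling takes \<open>s\<^sup>2\<close> out of the squared
      gradients but only one \<open>s\<close> out of the function values, whence the different
      powers in the two rates.\<close>
    have "Min ((\<lambda>i. (norm (s *\<^sub>R grad n f (x i)))\<^sup>2) ` {0..k}) = Min ((\<lambda>t. s\<^sup>2 * t) ` ?A)"
      by (simp add: image_image power_mult_distrib)
    also have "\<dots> = s\<^sup>2 * Min ?A"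
      by (rule mono_Min_commute[symmetric]) (auto intro!: monoI mult_left_mono)
    finally have "Min ?A * (s\<^sup>2 * (real k + 1) ^ 3) \<le> C * (norm (x0 - z))\<^sup>2"
      using r(1) by (simp add: mult_ac)
    moreover have "(f (x k) - f z) * (s * (real k + 1)\<^sup>2) \<le> C * (norm (x0 - z))\<^sup>2"
      using r(2) by (simp add: mult_ac)
    moreover have "s\<^sup>2 * (real k + 1) ^ 3 > 0" "s * (real k + 1)\<^sup>2 > 0"
      using \<open>0 < s\<close> by auto
    ultimately show ?thesis
      by (simp only: pos_le_divide_eq)
  qed
  then show ?thesis
    using c C by blast
qed

end
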